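(* Let $\beta$ be the unit speed geodesic line in the Hilbert disc $(\mathbb{D},F_H)$ with initial point $\beta(0)=p\in\mathbb{D}$ and forward hitting point $y\in\partial\mathbb{D}$. Then the Busemann function of the line $\beta$ is, for $x\in\mathbb{D}$, $$b_\beta(x)=\frac12\ln\frac{(1-|x|^2)(1-\langle p,y\rangle)^2}{(1-|p|^2)(1-\langle x,y\rangle)^2}.$$
   Context: $\mathbb{D}=\{x\in\mathbb{R}^2:|x|<1\}$, with $|\cdot|$ and $\langle\cdot,\cdot\rangle$ the Euclidean norm and inner product. The Hilbert metric on $\mathbb{D}$ is $F_H(x,v)=\dfrac{\sqrt{(1-|x|^2)|v|^2+\langle x,v\rangle^2}}{1-|x|^2}$. Its distance is $d_H(x_1,x_2)=\dfrac12\ln\dfrac{|x_2-b|\,|x_1-a|}{|x_1-b|\,|x_2-a|}$ for $x_1\neq x_2$, where $a$ is the point at which the ray from $x_1$ through $x_2$ meets $\partial\mathbb{D}$ and $b$ is the point at which the ray from $x_2$ through $x_1$ meets $\partial\mathbb{D}$; $d_H(x,x)=0$. The unit speed geodesic with $\beta(0)=p$ and forward hitting point $y$ is $\beta(t)=(1-s(t))p+s(t)y$, $t\in\mathbb{R}$, where $s(t)=\dfrac{e^t-e^{-t}}{e^t+k e^{-t}}$ and $k=\dfrac{|y-p|^2}{|y|^2-|p|^2}$. The Busemann function is $b_\beta(x)=\lim_{t\to\infty}\{t-d_H(x,\beta(t))\}$. *)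

theory Defs
  imports "HOL-Analysis.Analysis"
begin

definition hilbert_disc :: "(real ^ 2) set" where
  "hilbert_disc = {x. norm x < 1}"

definition hilbert_metric :: "real ^ 2 \<Rightarrow> real ^ 2 \<Rightarrow> real" where
  "hilbert_metric x v =
     sqrt ((1 - (norm x)\<^sup>2) * (norm v)\<^sup>2 + (x \<bullet> v)\<^sup>2) / (1 - (norm x)\<^sup>2)"

text \<open>The point at which the ray from \<open>u\<close> through \<open>v\<close> meets the unit circle; it is
  well defined for \<open>u\<close> in the open disc and \<open>v \<noteq> u\<close> (see \<open>ray_exit_unique\<close> below).\<close>
definition ray_exit :: "real ^ 2 \<Rightarrow> real ^ 2 \<Rightarrow> real ^ 2" where
  "ray_exit u v = (THE a. a \<in> frontier hilbert_disc \<and> (\<exists>r\<ge>0. a = u + r *\<^sub>R (v - u)))"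

definition hilbert_dist :: "real ^ 2 \<Rightarrow> real ^ 2 \<Rightarrow> real" where
  "hilbert_dist u v =
     (if u = v then 0
      else let a = ray_exit u v; b = ray_exit v u
           in 1 / 2 * ln ((norm (v - b) * norm (u - a)) / (norm (u - b) * norm (v - a))))"

definition geodesic_const :: "real ^ 2 \<Rightarrow> real ^ 2 \<Rightarrow> real" where
  "geodesic_const p y = (norm (y - p))\<^sup>2 / ((norm y)\<^sup>2 - (norm p)\<^sup>2)"

definition geodesic_param :: "real ^ 2 \<Rightarrow> real ^ 2 \<Rightarrow> real \<Rightarrow> real" where
  "geodesic_param p y t =
     (exp t - exp (- t)) / (exp t + geodesic_const p y * exp (- t))"

text \<open>The unit speed geodesic line of the Hilbert disc with initial point \<open>p\<close> and forward
  hitting point \<open>y\<close>, given by its explicit parametrization of the chord. The facts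
  \<open>hilbert_geodesic_0\<close> to \<open>hilbert_geodesic_unit_speed\<close> below confirm the initial point,
  the hitting point and the unit speed.\<close>
definition hilbert_geodesic :: "real ^ 2 \<Rightarrow> real ^ 2 \<Rightarrow> real \<Rightarrow> real ^ 2" where
  "hilbert_geodesic p y t =
     (1 - geodesic_param p y t) *\<^sub>R p + geodesic_param p y t *\<^sub>R y"

text \<open>\<open>Lim\<close> is a definite description and carries information only where the limit exists.\<close>
definition busemann :: "(real \<Rightarrow> real ^ 2) \<Rightarrow> real ^ 2 \<Rightarrow> real" where
  "busemann \<beta> x = Lim at_top (\<lambda>t. t - hilbert_dist x (\<beta> t))"

lemma frontier_hilbert_disc: "frontier hilbert_disc = {x. norm x = 1}"
proof -
  have "hilbert_disc = ball 0 1"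
    by (auto simp: hilbert_disc_def)
  then have "frontier hilbert_disc = sphere 0 1"
    using frontier_ball[of 1 "0 :: real ^ 2"] by simp
  then show ?thesis
    by (auto simp: sphere_def)
qed

lemma ray_exit_unique:
  assumes u: "u \<in> hilbert_disc" and "u \<noteq> v"
  shows "\<exists>!a. a \<in> frontier hilbert_disc \<and> (\<exists>r\<ge>0. a = u + r *\<^sub>R (v - u))"
proof -
  define w where "w = v - u"
  have w: "norm w > 0" using \<open>u \<noteq> v\<close> by (simp add: w_def)
  have nu: "norm u < 1" using u by (simp add: hilbert_disc_def)
  define f where "f r = norm (u + r *\<^sub>R w)" for r
  have f0: "f 0 < 1" using nu by (simp add: f_def)
  have f1: "f (2 / norm w) \<ge> 1"
  proof -
    have "norm ((2 / norm w) *\<^sub>R w) \<le> f (2 / norm w) + norm u"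
      unfolding f_def by (metis add_diff_cancel_left' norm_triangle_ineq4)
    moreover have "norm ((2 / norm w) *\<^sub>R w) = 2" using w by simp
    ultimately show ?thesis using nu by linarith
  qed
  have "continuous_on {0..2 / norm w} f"
    unfolding f_def by (intro continuous_intros)
  then obtain r where r: "0 \<le> r" "f r = 1"
    using IVT'[of f 0 1 "2 / norm w"] f0 f1 w by auto
  have strict: "f s < 1" if "0 \<le> s" "s < t" "f t = 1" for s t
  proof -
    have t: "t > 0" using that by simp
    define c where "c = s / t"
    have c: "0 \<le> c" "c < 1" using that t by (auto simp: c_def)
    have st: "s = c * t" using t by (simp add: c_def)
    have "u + s *\<^sub>R w = (1 - c) *\<^sub>R u + c *\<^sub>R (u + t *\<^sub>R w)"
      by (simp add: st algebra_simps)
    then have "f s \<le> norm ((1 - c) *\<^sub>R u) + norm (c *\<^sub>R (u + t *\<^sub>R w))"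
      unfolding f_def by (metis norm_triangle_ineq)
    also have "\<dots> = (1 - c) * norm u + c * f t"
      using c by (simp add: f_def)
    also have "\<dots> < (1 - c) * 1 + c * 1"
      unfolding that(3) using c nu by (intro add_strict_right_mono mult_strict_left_mono) auto
    finally show ?thesis by simp
  qed
  have uniq: "s = t" if "0 \<le> s" "0 \<le> t" "f s = 1" "f t = 1" for s t
    using strict[of s t] strict[of t s] that by linarith
  show ?thesis
    unfolding frontier_hilbert_disc w_def[symmetric] mem_Collect_eq
  proof (rule ex1I[of _ "u + r *\<^sub>R w"])
    show "norm (u + r *\<^sub>R w) = 1 \<and> (\<exists>r'\<ge>0. u + r *\<^sub>R w = u + r' *\<^sub>R w)"
      using r unfolding f_def by blast
  next
    fix a
    assume "norm a = 1 \<and> (\<exists>r\<ge>0. a = u + r *\<^sub>R w)"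
    then obtain r' where r': "r' \<ge> 0" "a = u + r' *\<^sub>R w" "f r' = 1"
      unfolding f_def by blast
    then show "a = u + r *\<^sub>R w"
      using uniq r by blast
  qed
qed

context
  fixes p y :: "real ^ 2"
  assumes p: "p \<in> hilbert_disc" and y: "y \<in> frontier hilbert_disc"
begin

private lemma norms: "norm p < 1" "norm y = 1" "y \<noteq> p" "(norm p)\<^sup>2 < 1"
proof -
  show np: "norm p < 1" using p by (simp add: hilbert_disc_def)
  show ny: "norm y = 1" using y unfolding frontier_hilbert_disc by simp
  show "y \<noteq> p" using np ny by force
  show "(norm p)\<^sup>2 < 1" using np by (simp add: abs_square_less_1)
qed

lemma geodesic_const_pos: "geodesic_const p y > 0"
  using norms by (simp add: geodesic_const_def)

private lemma denom_pos: "exp t + geodesic_const p y * exp (- t) > 0"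
  using geodesic_const_pos by (simp add: add_pos_pos)

lemma hilbert_geodesic_0: "hilbert_geodesic p y 0 = p"
  by (simp add: hilbert_geodesic_def geodesic_param_def)

lemma geodesic_param_at_top: "(geodesic_param p y \<longlongrightarrow> 1) at_top"
proof -
  have e: "((\<lambda>t::real. exp (- 2 * t)) \<longlongrightarrow> 0) at_top"
    by (rule filterlim_compose[OF exp_at_bot])
       (rule filterlim_tendsto_neg_mult_at_bot[OF tendsto_const _ filterlim_ident], simp)
  have "((\<lambda>t. (1 - exp (- 2 * t)) / (1 + geodesic_const p y * exp (- 2 * t)))
      \<longlongrightarrow> (1 - 0) / (1 + geodesic_const p y * 0)) at_top"
    by (intro tendsto_intros e) simp
  moreover have "(1 - exp (- 2 * t)) / (1 + geodesic_const p y * exp (- 2 * t)) = geodesic_param p y t" for t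
  proof -
    have e2: "exp t * exp (- 2 * t) = exp (- t)"
      unfolding exp_add[symmetric] by (rule arg_cong[where f = exp]) simp
    have "(1 - exp (- 2 * t)) / (1 + geodesic_const p y * exp (- 2 * t))
        = (exp t * (1 - exp (- 2 * t))) / (exp t * (1 + geodesic_const p y * exp (- 2 * t)))"
      by (rule mult_divide_mult_cancel_left[symmetric]) (rule exp_not_eq_zero)
    also have "\<dots> = (exp t - exp t * exp (- 2 * t))
        / (exp t + geodesic_const p y * (exp t * exp (- 2 * t)))"
      by (rule arg_cong2[where f = "(/)"]) (algebra, algebra)
    finally show ?thesis unfolding e2 geodesic_param_def .
  qed
  ultimately show ?thesis by simp
qed

lemma hilbert_geodesic_at_top: "(hilbert_geodesic p y \<longlongrightarrow> y) at_top"
proof -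
  have "((\<lambda>t. (1 - geodesic_param p y t) *\<^sub>R p + geodesic_param p y t *\<^sub>R y)
      \<longlongrightarrow> (1 - 1) *\<^sub>R p + 1 *\<^sub>R y) at_top"
    by (intro tendsto_intros geodesic_param_at_top)
  then show ?thesis by (simp add: hilbert_geodesic_def[abs_def])
qed

private lemma one_minus_norm:
  "1 - (norm (p + s *\<^sub>R (y - p)))\<^sup>2
     = (1 - (norm p)\<^sup>2) * ((1 - s) * (1 + s * geodesic_const p y))"
proof -
  have yy: "y \<bullet> y = 1" using norms by (simp add: norm_eq_1)
  have n: "1 - p \<bullet> p \<noteq> 0" using norms by (simp add: power2_norm_eq_inner)
  have k: "geodesic_const p y * (1 - p \<bullet> p) = (y - p) \<bullet> (y - p)"
    using n yy by (simp add: geodesic_const_def power2_norm_eq_inner)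
  have "(1 - p \<bullet> p) * ((1 - s) * (1 + s * geodesic_const p y))
     = (1 - s) * ((1 - p \<bullet> p) + s * (geodesic_const p y * (1 - p \<bullet> p)))"
    by (simp add: algebra_simps)
  also have "\<dots> = 1 - (p + s *\<^sub>R (y - p)) \<bullet> (p + s *\<^sub>R (y - p))"
    unfolding k by (simp add: inner_diff inner_add yy inner_commute[of y p]) (simp add: yy algebra_simps)
  finally show ?thesis by (simp add: power2_norm_eq_inner)
qed

private lemma geodesic_eq:
  "hilbert_geodesic p y t = p + geodesic_param p y t *\<^sub>R (y - p)"
  by (simp add: hilbert_geodesic_def algebra_simps)

private lemma param_prod:
  "(1 - geodesic_param p y t) * (1 + geodesic_param p y t * geodesic_const p y)
     = (1 + geodesic_const p y)\<^sup>2 / (exp t + geodesic_const p y * exp (- t))\<^sup>2"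
proof -
  define k where "k = geodesic_const p y"
  define E where "E = exp t"
  define G where "G = exp (- t)"
  define d where "d = E + k * G"
  have EG: "E * G = 1" by (simp add: E_def G_def exp_minus)
  have d: "d \<noteq> 0" using denom_pos[of t] by (simp add: d_def E_def G_def k_def)
  have s: "geodesic_param p y t = (E - G) / d"
    by (simp add: geodesic_param_def E_def G_def k_def d_def)
  have "1 - (E - G) / d = (1 + k) * G / d"
    using d by (simp add: field_simps) (simp add: d_def algebra_simps)
  moreover have "1 + (E - G) / d * k = (1 + k) * E / d"
    using d by (simp add: field_simps) (simp add: d_def algebra_simps)
  ultimately have "(1 - (E - G) / d) * (1 + (E - G) / d * k) = ((1 + k)\<^sup>2 * (E * G)) / d\<^sup>2"
    by (simp add: power2_eq_square)
  then show ?thesis by (simp add: s EG) (simp add: d_def E_def G_def k_def)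
qed

lemma hilbert_geodesic_in_disc: "hilbert_geodesic p y t \<in> hilbert_disc"
proof -
  have "1 - (norm (hilbert_geodesic p y t))\<^sup>2 > 0"
    unfolding geodesic_eq one_minus_norm param_prod
    using norms denom_pos[of t] geodesic_const_pos by simp
  then show ?thesis
    by (simp add: hilbert_disc_def abs_square_less_1)
qed

lemma hilbert_geodesic_unit_speed:
  "\<exists>v. (hilbert_geodesic p y has_vector_derivative v) (at t) \<and>
       hilbert_metric (hilbert_geodesic p y t) v = 1"
proof -
  define k where "k = geodesic_const p y"
  define d where "d = exp t + k * exp (- t)"
  define w where "w = y - p"
  define s where "s = geodesic_param p y t"
  define N where "N = 1 - p \<bullet> p"
  define q where "q = w \<bullet> w"
  define c where "c = 2 * (1 + k) / d\<^sup>2"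
  have d: "d > 0" using denom_pos[of t] by (simp add: d_def k_def)
  have k: "k > 0" using geodesic_const_pos by (simp add: k_def)
  have N: "N > 0" using norms by (simp add: N_def power2_norm_eq_inner)
  have yy: "y \<bullet> y = 1" using norms by (simp add: norm_eq_1)
  have q: "q = k * N"
    using N yy by (simp add: k_def geodesic_const_def power2_norm_eq_inner q_def w_def N_def)
  have EG: "exp t * exp (- t) = (1::real)" by (simp add: exp_minus)
  have "((\<lambda>t. (exp t - exp (- t)) / (exp t + k * exp (- t))) has_real_derivative
      ((exp t + exp (- t)) * d - (exp t - exp (- t)) * (exp t - k * exp (- t))) / (d * d)) (at t)"
    unfolding d_def using d by (auto intro!: derivative_eq_intros simp: d_def)
  moreover have "(exp t + exp (- t)) * d - (exp t - exp (- t)) * (exp t - k * exp (- t))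
      = 2 * (1 + k) * (exp t * exp (- t))"
    unfolding d_def by (simp add: algebra_simps del: EG)
  ultimately have "(geodesic_param p y has_real_derivative c) (at t)"
    by (simp add: geodesic_param_def[abs_def] k_def[symmetric] EG c_def power2_eq_square)
  then have "((\<lambda>t. p + geodesic_param p y t *\<^sub>R w) has_vector_derivative c *\<^sub>R w) (at t)"
    by (auto intro!: derivative_eq_intros simp: has_real_derivative_iff_has_vector_derivative)
  then have der: "(hilbert_geodesic p y has_vector_derivative c *\<^sub>R w) (at t)"
    by (simp add: geodesic_eq[abs_def] w_def)
  have one: "1 - (norm (p + s *\<^sub>R w))\<^sup>2 = N * ((1 - s) * (1 + s * k))"
    unfolding w_def k_def N_def one_minus_norm by (simp add: power2_norm_eq_inner)
  have pw: "p \<bullet> w = (N - q) / 2"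
    by (simp add: N_def q_def w_def inner_diff yy inner_commute[of y p])
  have "(p + s *\<^sub>R w) \<bullet> w = (N - q) / 2 + s * q"
    by (simp add: inner_add_left pw q_def)
  then have "(1 - (norm (p + s *\<^sub>R w))\<^sup>2) * (norm w)\<^sup>2 + ((p + s *\<^sub>R w) \<bullet> w)\<^sup>2
      = N * ((1 - s) * (1 + s * k)) * q + ((N - q) / 2 + s * q)\<^sup>2"
    by (simp add: one) (simp add: power2_norm_eq_inner q_def)
  also have "\<dots> = ((N + q) / 2)\<^sup>2"
    unfolding q by (simp add: power2_eq_square field_simps)
  finally have core: "(1 - (norm (p + s *\<^sub>R w))\<^sup>2) * (norm w)\<^sup>2 + ((p + s *\<^sub>R w) \<bullet> w)\<^sup>2
      = ((N + q) / 2)\<^sup>2" .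
  have "(1 - (norm (p + s *\<^sub>R w))\<^sup>2) * (norm (c *\<^sub>R w))\<^sup>2 + ((p + s *\<^sub>R w) \<bullet> (c *\<^sub>R w))\<^sup>2
      = c\<^sup>2 * ((1 - (norm (p + s *\<^sub>R w))\<^sup>2) * (norm w)\<^sup>2 + ((p + s *\<^sub>R w) \<bullet> w)\<^sup>2)"
    unfolding inner_scaleR_right norm_scaleR power_mult_distrib power2_abs
    by (simp only: distrib_left mult_ac)
  also have "\<dots> = (c * ((N + q) / 2))\<^sup>2"
    unfolding core power_mult_distrib ..
  finally have "sqrt ((1 - (norm (p + s *\<^sub>R w))\<^sup>2) * (norm (c *\<^sub>R w))\<^sup>2
      + ((p + s *\<^sub>R w) \<bullet> (c *\<^sub>R w))\<^sup>2) = c * ((N + q) / 2)"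
    using k N d by (simp add: c_def q)
  moreover have "(1 - s) * (1 + s * k) = (1 + k)\<^sup>2 / d\<^sup>2"
    unfolding s_def k_def d_def by (rule param_prod)
  ultimately have "hilbert_metric (p + s *\<^sub>R w) (c *\<^sub>R w)
      = c * ((N + q) / 2) / (N * ((1 + k)\<^sup>2 / d\<^sup>2))"
    unfolding hilbert_metric_def by (simp only: one)
  also have "\<dots> = 1"
  proof -
    have "c * ((N + q) / 2) = N * ((1 + k)\<^sup>2 / d\<^sup>2)"
      by (simp add: c_def q power2_eq_square algebra_simps add_divide_distrib)
    moreover have "N * ((1 + k)\<^sup>2 / d\<^sup>2) \<noteq> 0" using N k d by simp
    ultimately show ?thesis by simp
  qed
  finally show ?thesis
    using der unfolding geodesic_eq[of t] s_def w_def by blast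
qed

end

end

(* Solving for the two ends of the chord through u and v gives the closed form
     d_H(u,v) = 1/2 ln ((M + sqrt (M^2 - U V))^2 / (U V)),
   M = 1 - <u,v>, U = 1 - |u|^2, V = 1 - |v|^2.  Along the geodesic, V tends to 0, M tends to
   1 - <x,y>, and e^(2t) V tends to 4 (1 - <p,y>)^2 / (1 - |p|^2); hence t - d_H(x, beta t)
   = 1/2 ln (e^(2t) U V / (M + sqrt (M^2 - U V))^2) converges to the asserted value. *)
theory Submission
  imports Defs
begin

lemma ray_exit_eqI:
  assumes "u \<in> hilbert_disc" "u \<noteq> v" "r \<ge> 0" "norm (u + r *\<^sub>R (v - u)) = 1"
  shows "ray_exit u v = u + r *\<^sub>R (v - u)"
  unfolding ray_exit_def
  by (rule the1_equality[OF ray_exit_unique[OF assms(1,2)]])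
     (use assms in \<open>auto simp: frontier_hilbert_disc\<close>)

lemma one_minus_inner_self_pos:
  assumes "u \<in> hilbert_disc"
  shows "1 - u \<bullet> u > 0"
  using assms by (simp add: hilbert_disc_def flip: power2_norm_eq_inner add: abs_square_less_1)

text \<open>With \<open>w = v - u\<close>, the ends of the chord are \<open>u + z w\<close> for the
  two roots \<open>z\<close> of \<open>A z^2 + 2 B z = C\<close>, one beyond \<open>v\<close> and
  one behind \<open>u\<close>. The four lengths in the cross-ratio are multiples of
  \<open>|w|\<close>, and Vieta's formulas evaluate their quotient. The formula covers
  \<open>u = v\<close>, where the quotient is 1, so no case distinction is needed along a
  geodesic.\<close>

lemma hilbert_dist_eq:
  assumes u: "u \<in> hilbert_disc" and v: "v \<in> hilbert_disc"
  shows "hilbert_dist u v =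
    1 / 2 * ln ((1 - u \<bullet> v + sqrt ((1 - u \<bullet> v)\<^sup>2 - (1 - u \<bullet> u) * (1 - v \<bullet> v)))\<^sup>2
                / ((1 - u \<bullet> u) * (1 - v \<bullet> v)))"
proof (cases "u = v")
  case True
  then show ?thesis
    using one_minus_inner_self_pos[OF u] by (simp add: hilbert_dist_def power2_eq_square)
next
  case False
  define w where "w = v - u"
  define A where "A = w \<bullet> w"
  define B where "B = u \<bullet> w"
  define C where "C = 1 - u \<bullet> u"
  define V where "V = 1 - v \<bullet> v"
  \<comment> \<open>A quarter of the discriminant of the quadratic; its roots are
    \<open>r = (S - B) / A\<close> and \<open>- q = (- S - B) / A\<close>.\<close>
  define D where "D = B\<^sup>2 + A * C"
  define S where "S = sqrt D"
  have A: "A > 0" using False by (simp add: A_def w_def)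
  have C: "C > 0" and V: "V > 0"
    using u v by (auto simp: C_def V_def intro: one_minus_inner_self_pos[simplified])
  have M: "1 - u \<bullet> v = C - B"
    by (simp add: C_def B_def w_def inner_diff)
  have V_eq: "V = C - 2 * B - A"
    by (simp add: V_def C_def B_def A_def w_def inner_diff inner_commute)
  have D_eq: "D = (C - B)\<^sup>2 - C * V"
    by (simp add: D_def V_eq power2_eq_square algebra_simps)
  have SS: "S * S = B * B + A * C"
    using A C by (simp add: S_def D_def power2_eq_square)
  \<comment> \<open>The differences are \<open>A * C\<close> and \<open>A * V\<close>: the quadratic
    \<open>A z^2 + 2 B z - C\<close> is negative at \<open>z = 0\<close> and \<open>z = 1\<close>,
    since \<open>u\<close> and \<open>v\<close> lie inside the disc. This places the roots outside
    \<open>[0, 1]\<close>.\<close>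
  have "B\<^sup>2 < D" "(A + B)\<^sup>2 < D"
    using mult_pos_pos[OF A V] mult_pos_pos[OF A C]
    by (simp_all add: D_def V_eq power2_eq_square algebra_simps)
  then have S: "\<bar>B\<bar> < S" "\<bar>A + B\<bar> < S"
    unfolding S_def by (metis real_sqrt_abs real_sqrt_less_mono)+
  define r where "r = (S - B) / A"
  define q where "q = (S + B) / A"
  have r: "r > 1" and q: "q > 0"
    using S A by (auto simp: r_def q_def field_simps)
  have on_circle: "norm (u + z *\<^sub>R w) = 1" if "A * z * z + 2 * B * z = C" for z
    using that by (simp add: norm_eq_1 inner_add inner_commute A_def B_def C_def algebra_simps)
  have a: "norm (u + r *\<^sub>R w) = 1"
    by (rule on_circle) (use A SS in \<open>simp add: r_def field_simps power2_eq_square\<close>)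
  have b: "norm (u + (- q) *\<^sub>R w) = 1"
    by (rule on_circle) (use A SS in \<open>simp add: q_def field_simps power2_eq_square\<close>)
  have ray_a: "ray_exit u v = u + r *\<^sub>R w"
    unfolding w_def by (rule ray_exit_eqI) (use u False r a in \<open>auto simp: w_def\<close>)
  \<comment> \<open>Measured from \<open>v\<close> towards \<open>u\<close>, the rear end of the
    chord has parameter \<open>1 + q\<close>.\<close>
  have vb: "v + (1 + q) *\<^sub>R (u - v) = u + (- q) *\<^sub>R w"
    by (simp add: w_def algebra_simps)
  have ray_b: "ray_exit v u = u + (- q) *\<^sub>R w"
    unfolding vb[symmetric] by (rule ray_exit_eqI) (use v False q b in \<open>auto simp: vb\<close>)
  have diffs: "v - (u + (- q) *\<^sub>R w) = (1 + q) *\<^sub>R w" "u - (u + r *\<^sub>R w) = (- r) *\<^sub>R w"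
      "u - (u + (- q) *\<^sub>R w) = q *\<^sub>R w" "v - (u + r *\<^sub>R w) = (1 - r) *\<^sub>R w"
    by (simp_all add: w_def algebra_simps)
  have w: "norm w \<noteq> 0" using False by (simp add: w_def)
  \<comment> \<open>Evaluate the factorization \<open>A (z - r) (z + q)\<close> of the quadratic at
    \<open>z = 0\<close> and \<open>z = 1\<close>; the third identity adds \<open>r\<close> to
    \<open>r * q\<close>.\<close>
  have rq: "r * q = C / A" and rq': "(1 + q) * (r - 1) = V / A"
    and rq'': "(1 + q) * r = (C - B + S) / A"
    using A SS by (simp_all add: r_def q_def V_eq field_simps)
  have "hilbert_dist u v = 1 / 2 * ln (((1 + q) * r) / (q * (r - 1)))"
    unfolding hilbert_dist_def Let_def ray_a ray_b diffs norm_scaleR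
    using False w r q by simp
  \<comment> \<open>Expanding by \<open>(1 + q) * r\<close> makes the denominator a product of the
    two known quantities, and \<open>A^2\<close> cancels.\<close>
  also have "((1 + q) * r) / (q * (r - 1)) = ((1 + q) * r)\<^sup>2 / ((r * q) * ((1 + q) * (r - 1)))"
    using r q by (simp add: divide_simps power2_eq_square)
  also have "\<dots> = (C - B + S)\<^sup>2 / (C * V)"
    unfolding rq rq' rq'' using A by (simp add: power2_eq_square)
  finally show ?thesis
    unfolding M S_def D_eq by (simp only: C_def V_def)
qed

text \<open>On the chord the left side is a quadratic polynomial in the parameter, with root 1
  because \<open>|y| = 1\<close>. Splitting off that root isolates the only factor that decays as
  \<open>t\<close> grows.\<close>

lemma one_minus_inner_geodesic:
  assumes "y \<in> frontier hilbert_disc"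
  shows "1 - hilbert_geodesic p y t \<bullet> hilbert_geodesic p y t =
    (1 - geodesic_param p y t) *
      ((1 - p \<bullet> p) + geodesic_param p y t * (2 * (1 - p \<bullet> y) - (1 - p \<bullet> p)))"
proof -
  have "y \<bullet> y = 1"
    using assms by (simp add: frontier_hilbert_disc norm_eq_1)
  then show ?thesis
    by (simp add: hilbert_geodesic_def inner_add inner_commute algebra_simps)
qed

text \<open>The numerator of \<open>1 - geodesic_param p y t\<close> collapses to
  \<open>(1 + k) exp (- t)\<close>, which fixes both the decay rate and the constant.\<close>

lemma exp_one_minus_geodesic_param_at_top:
  assumes p: "p \<in> hilbert_disc" and y: "y \<in> frontier hilbert_disc"
  shows "((\<lambda>t. exp (2 * t) * (1 - geodesic_param p y t)) \<longlongrightarrow> 1 + geodesic_const p y) at_top"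
proof -
  define k where "k = geodesic_const p y"
  have k: "k > 0" using geodesic_const_pos[OF p y] by (simp add: k_def)
  have e: "((\<lambda>t::real. exp (- 2 * t)) \<longlongrightarrow> 0) at_top"
    by (rule filterlim_compose[OF exp_at_bot])
       (rule filterlim_tendsto_neg_mult_at_bot[OF tendsto_const _ filterlim_ident], simp)
  have "((\<lambda>t::real. (1 + k) / (1 + k * exp (- 2 * t))) \<longlongrightarrow> (1 + k) / (1 + k * 0)) at_top"
    by (intro tendsto_intros e) simp
  moreover have "exp (2 * t) * (1 - geodesic_param p y t) = (1 + k) / (1 + k * exp (- 2 * t))" for t
  proof -
    define E where "E = exp t"
    have E: "E > 0" "exp (2 * t) = E\<^sup>2" "exp (- 2 * t) = 1 / E\<^sup>2" "exp (- t) = 1 / E"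
      by (simp_all add: E_def exp_minus exp_double inverse_eq_divide)
    have d: "E\<^sup>2 + k > 0" using E(1) k by (simp add: add_pos_pos)
    have "geodesic_param p y t = (E\<^sup>2 - 1) / (E\<^sup>2 + k)"
      unfolding geodesic_param_def E(4) E_def[symmetric] k_def[symmetric]
      using E(1) d by (simp add: divide_simps power2_eq_square)
    then have "1 - geodesic_param p y t = (1 + k) / (E\<^sup>2 + k)"
      using d by (simp add: field_simps)
    then show ?thesis
      unfolding E using E(1) d by (simp add: divide_simps)
  qed
  ultimately show ?thesis by (simp add: k_def)
qed

lemma exp_one_minus_inner_geodesic_at_top:
  assumes p: "p \<in> hilbert_disc" and y: "y \<in> frontier hilbert_disc"
  shows "((\<lambda>t. exp (2 * t) * (1 - hilbert_geodesic p y t \<bullet> hilbert_geodesic p y t))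
    \<longlongrightarrow> 4 * (1 - p \<bullet> y)\<^sup>2 / (1 - p \<bullet> p)) at_top"
proof -
  have N: "1 - p \<bullet> p > 0" by (rule one_minus_inner_self_pos[OF p])
  have yy: "y \<bullet> y = 1"
    using y by (simp add: frontier_hilbert_disc norm_eq_1)
  \<comment> \<open>By \<open>|y| = 1\<close>, the sum \<open>|y - p|^2 + (|y|^2 - |p|^2)\<close>
    equals \<open>2 (1 - <p,y>)\<close>.\<close>
  have k: "1 + geodesic_const p y = 2 * (1 - p \<bullet> y) / (1 - p \<bullet> p)"
    using N by (simp add: geodesic_const_def power2_norm_eq_inner yy inner_diff inner_commute
        field_simps)
  have "((\<lambda>t. (exp (2 * t) * (1 - geodesic_param p y t)) *
      ((1 - p \<bullet> p) + geodesic_param p y t * (2 * (1 - p \<bullet> y) - (1 - p \<bullet> p))))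
    \<longlongrightarrow> (1 + geodesic_const p y) *
      ((1 - p \<bullet> p) + 1 * (2 * (1 - p \<bullet> y) - (1 - p \<bullet> p)))) at_top"
    by (intro tendsto_intros exp_one_minus_geodesic_param_at_top geodesic_param_at_top p y)
  then show ?thesis
    unfolding one_minus_inner_geodesic[OF y] k by (simp add: power2_eq_square algebra_simps)
qed

theorem theorem6p2:
  fixes p y x :: "real ^ 2" and \<beta> :: "real \<Rightarrow> real ^ 2"
  assumes "p \<in> hilbert_disc"
    and "y \<in> frontier hilbert_disc"
    and "\<beta> = hilbert_geodesic p y"
    and "x \<in> hilbert_disc"
  shows "((\<lambda>t. t - hilbert_dist x (\<beta> t)) \<longlongrightarrow> busemann \<beta> x) at_top \<and>
    busemann \<beta> x =
      1 / 2 * ln (((1 - (norm x)\<^sup>2) * (1 - p \<bullet> y)\<^sup>2) /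
                  ((1 - (norm p)\<^sup>2) * (1 - x \<bullet> y)\<^sup>2))"
proof -
  note p = assms(1) and y = assms(2) and x = assms(4)
  define U where "U = 1 - x \<bullet> x"
  define V where "V t = 1 - \<beta> t \<bullet> \<beta> t" for t
  define M where "M t = 1 - x \<bullet> \<beta> t" for t
  define Q where "Q t = (M t + sqrt ((M t)\<^sup>2 - U * V t))\<^sup>2" for t
  define m where "m = 1 - x \<bullet> y"
  define L where "L = U * (1 - p \<bullet> y)\<^sup>2 / ((1 - p \<bullet> p) * m\<^sup>2)"
  have ny: "norm y = 1" using y by (simp add: frontier_hilbert_disc)
  have less_1: "z \<bullet> y < 1" if "z \<in> hilbert_disc" for z
    using norm_cauchy_schwarz[of z y] ny that by (simp add: hilbert_disc_def)
  have \<beta>: "\<beta> t \<in> hilbert_disc" for t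
    unfolding assms(3) by (rule hilbert_geodesic_in_disc[OF p y])
  have N: "1 - p \<bullet> p > 0" and U: "U > 0" and V: "V t > 0" for t
    unfolding U_def V_def by (intro one_minus_inner_self_pos p x \<beta>)+
  have m: "m > 0" and py: "1 - p \<bullet> y > 0"
    using less_1[OF x] less_1[OF p] by (simp_all add: m_def)
  have \<beta>_lim: "(\<beta> \<longlongrightarrow> y) at_top"
    unfolding assms(3) by (rule hilbert_geodesic_at_top[OF p y])
  have M_lim: "(M \<longlongrightarrow> m) at_top"
    unfolding M_def[abs_def] m_def by (intro tendsto_intros \<beta>_lim)
  have "(V \<longlongrightarrow> 1 - y \<bullet> y) at_top"
    unfolding V_def[abs_def] by (intro tendsto_intros \<beta>_lim)
  then have V_lim: "(V \<longlongrightarrow> 0) at_top"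
    using ny by (simp add: norm_eq_1)
  have "(Q \<longlongrightarrow> (m + sqrt (m\<^sup>2 - U * 0))\<^sup>2) at_top"
    unfolding Q_def[abs_def] by (intro tendsto_intros M_lim V_lim)
  \<comment> \<open>Since \<open>m > 0\<close>, the root of \<open>m^2\<close> is \<open>m\<close>,
    so the limit is \<open>(2 m)^2\<close>.\<close>
  then have Q_lim: "(Q \<longlongrightarrow> 4 * m\<^sup>2) at_top"
    using m by (simp add: power2_eq_square)
  have eV_lim: "((\<lambda>t. exp (2 * t) * V t) \<longlongrightarrow> 4 * (1 - p \<bullet> y)\<^sup>2 / (1 - p \<bullet> p)) at_top"
    unfolding V_def assms(3) by (rule exp_one_minus_inner_geodesic_at_top[OF p y])
  have Q: "eventually (\<lambda>t. Q t > 0) at_top"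
    using order_tendstoD(1)[OF Q_lim] m by simp
  \<comment> \<open>Pairing \<open>V\<close> with \<open>exp (2 * t)\<close> gives the argument of
    \<open>ln\<close> a positive limit, where \<open>ln\<close> is continuous.\<close>
  have "((\<lambda>t. 1 / 2 * ln (U * (exp (2 * t) * V t) / Q t)) \<longlongrightarrow>
      1 / 2 * ln (U * (4 * (1 - p \<bullet> y)\<^sup>2 / (1 - p \<bullet> p)) / (4 * m\<^sup>2))) at_top"
    using U N m py by (intro tendsto_intros eV_lim Q_lim) auto
  moreover have "eventually (\<lambda>t. 1 / 2 * ln (U * (exp (2 * t) * V t) / Q t)
      = t - hilbert_dist x (\<beta> t)) at_top"
    using Q
  proof eventually_elim
    case (elim t)
    \<comment> \<open>Writing \<open>t\<close> as half of \<open>ln (exp (2 * t))\<close> merges it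
      with the logarithm in the distance formula.\<close>
    have "U * (exp (2 * t) * V t) / Q t = exp (2 * t) / (Q t / (U * V t))"
      using U V[of t] elim by (simp add: field_simps)
    moreover have "Q t / (U * V t) > 0" using U V[of t] elim by simp
    ultimately have "ln (U * (exp (2 * t) * V t) / Q t) = 2 * t - ln (Q t / (U * V t))"
      by (simp only: ln_divide_pos exp_gt_zero ln_exp)
    moreover have "hilbert_dist x (\<beta> t) = 1 / 2 * ln (Q t / (U * V t))"
      unfolding hilbert_dist_eq[OF x \<beta>] Q_def M_def U_def V_def ..
    ultimately show ?case by simp
  qed
  moreover have "U * (4 * (1 - p \<bullet> y)\<^sup>2 / (1 - p \<bullet> p)) / (4 * m\<^sup>2) = L"
    unfolding L_def by simp
  ultimately have lim: "((\<lambda>t. t - hilbert_dist x (\<beta> t)) \<longlongrightarrow> 1 / 2 * ln L) at_top"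
    by (simp only: Lim_transform_eventually)
  \<comment> \<open>Convergence is already established, so uniqueness of limits identifies the value
    of \<open>Lim\<close>.\<close>
  then have b: "busemann \<beta> x = 1 / 2 * ln L"
    unfolding busemann_def by (intro tendsto_Lim) simp_all
  have "((\<lambda>t. t - hilbert_dist x (\<beta> t)) \<longlongrightarrow> busemann \<beta> x) at_top"
    using lim unfolding b .
  with b show ?thesis
    by (simp add: L_def U_def m_def power2_norm_eq_inner)
qed

end
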